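(* Let $n\ge3$ and let $m=x_1<x_2<\cdots<x_n=M$ be any $n$ integers. Then $$m_4\ge\begin{cases}\frac{(M-m)^4}{8n}+\frac{(n-4)(n-3)(n-2)(3n^2-18n+20)}{240n}, & n\text{ even},\\[2pt] \frac{(M-m)^4}{8n}+\frac{(n-3)(3n^4-36n^3+182n^2-444n+415)}{240n}, & n\text{ odd}.\end{cases}$$ Furthermore, if $\bar{x}$ is an integer, then $$m_4\ge\begin{cases}\frac{(M-m)^4}{8n}+\frac{(n-2)(3n^4-24n^3+92n^2-176n+120)}{240n}, & n\text{ even},\\[2pt] \frac{(M-m)^4}{8n}+\frac{(n-1)(n-2)(n-3)(3n^2-12n+5)}{240n}, & n\text{ odd}.\end{cases}$$ Moreover, assuming that $n$ is odd, $\bar{x}$ is an integer, and $\bar{x}=\frac{m+M}{2}$, equality $m_4=\frac{(M-m)^4}{8n}+\frac{(n-1)(n-2)(n-3)(3n^2-12n+5)}{240n}$ holds precisely when $x_2,\dots,x_{n-1}$ are $n-2$ consecutive integers.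
   Context: $\bar x=\frac1n\sum_{i=1}^n x_i$ is the arithmetic mean and $m_4=\frac1n\sum_{i=1}^n(x_i-\bar x)^4$ is the fourth central moment. *)

theory Defs
  imports Complex_Main
begin

text \<open>Data points are indexed by 1, ..., n; the values of x outside this range are irrelevant.\<close>

definition arith_mean :: "nat \<Rightarrow> (nat \<Rightarrow> real) \<Rightarrow> real" where
  "arith_mean n x = (\<Sum>i=1..n. x i) / real n"

definition central_moment :: "nat \<Rightarrow> nat \<Rightarrow> (nat \<Rightarrow> real) \<Rightarrow> real" where
  "central_moment k n x = (\<Sum>i=1..n. (x i - arith_mean n x) ^ k) / real n"

end

theory Submission
  imports Defs
begin

text \<open>
  The two extreme points contribute at least \<open>(M - m)^4 / 8\<close> to \<open>n m\<^sub>4\<close>, by convexity of the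
  fourth power. Shifting by the floor of the mean turns the remaining points into \<open>n - 2\<close> distinct
  integers, each of which contributes at least \<open>t^4\<close> if \<open>t \<le> 0\<close> and \<open>(t - 1)^4\<close> if \<open>t > 0\<close>
  (exactly \<open>t^4\<close> if the mean is an integer). Among all sets of \<open>n - 2\<close> integers the sum of such a
  function is smallest on an interval around \<open>0\<close>, because there it lies below, and elsewhere above,
  a common threshold.
\<close>

text \<open>Cancelling the common part \<open>S \<inter> T\<close> leaves \<open>S - T\<close> and
  \<open>T - S\<close>, which have equal size, and \<open>c\<close> separates the values of
  \<open>f\<close> on them. The strict version serves the equality case.\<close>

lemma
  fixes f :: "'a \<Rightarrow> 'b::linordered_idom"
  assumes fin: "finite S" "finite T" and card: "card S = card T"
    and le: "\<And>t. t \<in> T \<Longrightarrow> f t \<le> c"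
  shows sum_le_sum_threshold: "(\<And>s. s \<notin> T \<Longrightarrow> c \<le> f s) \<Longrightarrow> sum f T \<le> sum f S"
    and sum_less_sum_threshold:
      "(\<And>s. s \<notin> T \<Longrightarrow> c < f s) \<Longrightarrow> S \<noteq> T \<Longrightarrow> sum f T < sum f S"
proof -
  have S: "sum f S = sum f (S \<inter> T) + sum f (S - T)"
    and T: "sum f T = sum f (S \<inter> T) + sum f (T - S)"
    using fin sum.Int_Diff[of S f T] sum.Int_Diff[of T f S] by (auto simp: Int_commute)
  have "card S = card (S \<inter> T) + card (S - T)" "card T = card (S \<inter> T) + card (T - S)"
    using fin card_Int_Diff[of S T] card_Int_Diff[of T S] by (auto simp: Int_commute)
  then have eq: "card (T - S) = card (S - T)"
    using card by simp
  have upper: "sum f (T - S) \<le> of_nat (card (S - T)) * c"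
    using sum_bounded_above[of "T - S" f c] le eq by auto
  show "sum f T \<le> sum f S" if "\<And>s. s \<notin> T \<Longrightarrow> c \<le> f s"
    using sum_bounded_below[of "S - T" c f] upper that S T by force
  show "sum f T < sum f S" if "\<And>s. s \<notin> T \<Longrightarrow> c < f s" "S \<noteq> T"
  proof -
    have "S - T \<noteq> {}"
      using that(2) card fin by (metis Diff_eq_empty_iff card_subset_eq)
    then have "(\<Sum>s\<in>S - T. c) < sum f (S - T)"
      using fin that(1) by (intro sum_strict_mono) auto
    then show ?thesis
      using upper S T by simp
  qed
qed

text \<open>The infimum of \<open>(t - r) ^ 4\<close> over \<open>0 \<le> r < 1\<close>, where
  \<open>r\<close> stands for the unknown fractional part of the mean.\<close>

definition quartic_below :: "int \<Rightarrow> int" where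
  "quartic_below t = (if t \<le> 0 then t ^ 4 else (t - 1) ^ 4)"

section \<open>Closed forms of the extremal sums\<close>

lemma sum_symmetric_Suc:
  fixes f :: "int \<Rightarrow> int"
  shows "sum f {- int (Suc N)..int (Suc N)}
    = f (- int N - 1) + f (int N + 1) + sum f {- int N..int N}"
proof -
  have "{- int (Suc N)..int (Suc N)}
      = insert (- int N - 1) (insert (int N + 1) {- int N..int N})"
    by auto
  then show ?thesis by simp
qed

lemma sum_centred_Suc:
  fixes f :: "int \<Rightarrow> int"
  shows "sum f {1 - int (Suc N)..int (Suc N)}
    = f (- int N) + f (int N + 1) + sum f {1 - int N..int N}"
proof -
  have "{1 - int (Suc N)..int (Suc N)} = insert (- int N) (insert (int N + 1) {1 - int N..int N})"
    by auto
  then show ?thesis by simp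
qed

text \<open>Here, as in the next three lemmas, \<open>n\<close> is the size of the whole sample, so
  the interval has \<open>n - 2\<close> elements. It is an \<open>int\<close> so that the
  subtractions are exact, and each induction step is a polynomial identity in
  \<open>N\<close>.\<close>

lemma sum_quartic_symmetric:
  assumes "n = 2 * int N + 3"
  shows "240 * (\<Sum>t\<in>{- int N..int N}. t ^ 4)
    = (n - 1) * (n - 2) * (n - 3) * (3 * n ^ 2 - 12 * n + 5)"
  using assms
proof (induction N arbitrary: n)
  case (Suc N)
  show ?case
    unfolding sum_symmetric_Suc distrib_left Suc.IH[OF refl] Suc.prems by simp algebra
qed simp

lemma sum_quartic_centred:
  assumes "n = 2 * int N + 2"
  shows "240 * (\<Sum>t\<in>{1 - int N..int N}. t ^ 4)
    = (n - 2) * (3 * n ^ 4 - 24 * n ^ 3 + 92 * n ^ 2 - 176 * n + 120)"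
  using assms
proof (induction N arbitrary: n)
  case (Suc N)
  show ?case
    unfolding sum_centred_Suc distrib_left Suc.IH[OF refl] Suc.prems by simp algebra
qed simp

lemma sum_quartic_below_symmetric:
  assumes "n = 2 * int N + 3"
  shows "240 * (\<Sum>t\<in>{- int N..int N}. quartic_below t)
    = (n - 3) * (3 * n ^ 4 - 36 * n ^ 3 + 182 * n ^ 2 - 444 * n + 415)"
  using assms
proof (induction N arbitrary: n)
  case (Suc N)
  show ?case
    unfolding sum_symmetric_Suc distrib_left Suc.IH[OF refl] Suc.prems
    by (simp add: quartic_below_def) algebra
qed (simp add: quartic_below_def)

lemma sum_quartic_below_centred:
  assumes "n = 2 * int N + 2"
  shows "240 * (\<Sum>t\<in>{1 - int N..int N}. quartic_below t)
    = (n - 4) * (n - 3) * (n - 2) * (3 * n ^ 2 - 18 * n + 20)"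
  using assms
proof (induction N arbitrary: n)
  case (Suc N)
  show ?case
    unfolding sum_centred_Suc distrib_left Suc.IH[OF refl] Suc.prems
    by (simp add: quartic_below_def) algebra
qed simp

section \<open>Minimal sums over integer sets of given size\<close>

lemma power4_le_iff: "a ^ 4 \<le> b ^ 4 \<longleftrightarrow> \<bar>a\<bar> \<le> \<bar>b\<bar>" for a b :: "'a::linordered_idom"
  using power_mono_iff[of "\<bar>a\<bar>" "\<bar>b\<bar>" 4] by (simp add: power_even_abs)

lemma power4_less_iff: "a ^ 4 < b ^ 4 \<longleftrightarrow> \<bar>a\<bar> < \<bar>b\<bar>" for a b :: "'a::linordered_idom"
  using power4_le_iff[of b a] by (simp add: not_le[symmetric])

text \<open>The threshold is \<open>N ^ 4\<close>. Integers outside the interval satisfy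
  \<open>\<bar>t\<bar> \<ge> N + 1\<close> and exceed it strictly, so the minimizer is
  unique.\<close>

lemma sum_quartic_ge_symmetric:
  assumes "finite S" "card S = 2 * N + 1"
  shows "(\<Sum>t\<in>{- int N..int N}. t ^ 4) \<le> (\<Sum>t\<in>S. t ^ 4)"
    and "(\<Sum>t\<in>S. t ^ 4) = (\<Sum>t\<in>{- int N..int N}. t ^ 4) \<longleftrightarrow> S = {- int N..int N}"
proof -
  have card: "card S = card {- int N..int N}"
    using assms by simp
  have le: "t ^ 4 \<le> int N ^ 4" if "t \<in> {- int N..int N}" for t
    using that by (simp add: power4_le_iff abs_le_iff)
  have less: "int N ^ 4 < t ^ 4" if "t \<notin> {- int N..int N}" for t
    using that by (simp add: power4_less_iff) linarith
  show "(\<Sum>t\<in>{- int N..int N}. t ^ 4) \<le> (\<Sum>t\<in>S. t ^ 4)"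
    by (rule sum_le_sum_threshold[OF assms(1) _ card le]) (use less in \<open>auto intro: less_imp_le\<close>)
  show "(\<Sum>t\<in>S. t ^ 4) = (\<Sum>t\<in>{- int N..int N}. t ^ 4) \<longleftrightarrow> S = {- int N..int N}"
    using sum_less_sum_threshold[OF assms(1) _ card le less] by fastforce
qed

text \<open>For an even number of points the threshold \<open>N ^ 4\<close> is also attained
  outside, at \<open>- N\<close>; hence only the weak comparison is available.\<close>

lemma sum_quartic_ge_centred:
  assumes "finite S" "card S = 2 * N"
  shows "(\<Sum>t\<in>{1 - int N..int N}. t ^ 4) \<le> (\<Sum>t\<in>S. t ^ 4)"
proof (rule sum_le_sum_threshold[OF assms(1)])
  show "card S = card {1 - int N..int N}"
    using assms by simp
  show "t ^ 4 \<le> int N ^ 4" if "t \<in> {1 - int N..int N}" for t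
    using that by (simp add: power4_le_iff abs_le_iff)
  show "int N ^ 4 \<le> t ^ 4" if "t \<notin> {1 - int N..int N}" for t
    using that by (simp add: power4_le_iff) linarith
qed simp

lemma sum_quartic_below_ge_symmetric:
  assumes "finite S" "card S = 2 * N + 1"
  shows "sum quartic_below {- int N..int N} \<le> sum quartic_below S"
proof (rule sum_le_sum_threshold[OF assms(1)])
  show "card S = card {- int N..int N}"
    using assms by simp
  show "quartic_below t \<le> int N ^ 4" if "t \<in> {- int N..int N}" for t
    using that by (auto simp: quartic_below_def power4_le_iff)
  show "int N ^ 4 \<le> quartic_below t" if "t \<notin> {- int N..int N}" for t
    using that by (auto simp: quartic_below_def power4_le_iff)
qed simp

text \<open>Replacing \<open>t\<close> by \<open>1 - t\<close> preserves both
  \<open>quartic_below\<close> and the interval, which is why an even number of points is centred at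
  1/2. Just outside, at \<open>- N\<close> and \<open>N + 1\<close>, the value is exactly
  \<open>N ^ 4\<close>.\<close>

lemma sum_quartic_below_ge_centred:
  assumes "finite S" "card S = 2 * N"
  shows "sum quartic_below {1 - int N..int N} \<le> sum quartic_below S"
proof (rule sum_le_sum_threshold[OF assms(1)])
  show "card S = card {1 - int N..int N}"
    using assms by simp
  show "quartic_below t \<le> int N ^ 4" if "t \<in> {1 - int N..int N}" for t
    using that by (auto simp: quartic_below_def power4_le_iff)
  show "int N ^ 4 \<le> quartic_below t" if "t \<notin> {1 - int N..int N}" for t
    using that by (auto simp: quartic_below_def power4_le_iff)
qed simp

section \<open>Lower bounds for one point and for the two extremes\<close>

text \<open>Since \<open>\<mu>\<close> lies between its floor and the next integer, its distance
  from \<open>t + \<lfloor>\<mu>\<rfloor>\<close> is at least \<open>- t\<close> when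
  \<open>t \<le> 0\<close> and at least \<open>t - 1\<close> otherwise.\<close>

lemma quartic_below_le:
  "real_of_int (quartic_below t) \<le> (real_of_int (t + \<lfloor>\<mu>\<rfloor>) - \<mu>) ^ 4"
proof (cases "t \<le> 0")
  case True
  then have "real_of_int t \<le> 0" by simp
  then have "real_of_int t ^ 4 \<le> (real_of_int (t + \<lfloor>\<mu>\<rfloor>) - \<mu>) ^ 4"
    unfolding power4_le_iff using of_int_floor_le[of \<mu>] by simp linarith
  with True show ?thesis by (simp add: quartic_below_def)
next
  case False
  then have "real_of_int t \<ge> 1" by linarith
  then have "(real_of_int t - 1) ^ 4 \<le> (real_of_int (t + \<lfloor>\<mu>\<rfloor>) - \<mu>) ^ 4"
    unfolding power4_le_iff using real_of_int_floor_add_one_gt[of \<mu>] by simp linarith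
  with False show ?thesis by (simp add: quartic_below_def)
qed

text \<open>With half-width \<open>p\<close> and offset \<open>q\<close> of the midpoint from
  \<open>\<mu>\<close>, the two deviations are \<open>q - p\<close> and \<open>q + p\<close>. Odd
  powers of \<open>p\<close> cancel in the sum, and \<open>2 * p ^ 4\<close> is the left-hand
  side.\<close>

lemma quartic_two_point:
  "(b - a) ^ 4 / 8 \<le> (a - \<mu>) ^ 4 + (b - \<mu>) ^ 4" for a b \<mu> :: real
proof -
  define p q where "p = (b - a) / 2" and "q = (a + b) / 2 - \<mu>"
  have "(a - \<mu>) ^ 4 + (b - \<mu>) ^ 4 - (b - a) ^ 4 / 8 = 2 * q ^ 4 + 12 * (p * q) ^ 2"
    unfolding p_def q_def by (simp add: power4_eq_xxxx power2_eq_square field_simps)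
  moreover have "0 \<le> 2 * q ^ 4 + 12 * (p * q) ^ 2" by simp
  ultimately show ?thesis by linarith
qed

section \<open>Bounds for the fourth central moment and the equality case\<close>

theorem theorem2p14:
  fixes n :: nat and x :: "nat \<Rightarrow> real" and m M :: real
  assumes "n \<ge> 3"
    and "\<forall>i\<in>{1..n}. x i \<in> \<int>"
    and "strict_mono_on {1..n} x"
    and "m = x 1" and "M = x n"
  shows
    "central_moment 4 n x \<ge>
       (if even n
        then (M - m) ^ 4 / (8 * real n)
          + (real n - 4) * (real n - 3) * (real n - 2) * (3 * real n ^ 2 - 18 * real n + 20)
            / (240 * real n)
        else (M - m) ^ 4 / (8 * real n)
          + (real n - 3) * (3 * real n ^ 4 - 36 * real n ^ 3 + 182 * real n ^ 2 - 444 * real n + 415)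
            / (240 * real n))
     \<and>
     (arith_mean n x \<in> \<int> \<longrightarrow>
       central_moment 4 n x \<ge>
       (if even n
        then (M - m) ^ 4 / (8 * real n)
          + (real n - 2) * (3 * real n ^ 4 - 24 * real n ^ 3 + 92 * real n ^ 2 - 176 * real n + 120)
            / (240 * real n)
        else (M - m) ^ 4 / (8 * real n)
          + (real n - 1) * (real n - 2) * (real n - 3) * (3 * real n ^ 2 - 12 * real n + 5)
            / (240 * real n)))
     \<and>
     (odd n \<and> arith_mean n x \<in> \<int> \<and> arith_mean n x = (m + M) / 2 \<longrightarrow>
       (central_moment 4 n x =
          (M - m) ^ 4 / (8 * real n)
          + (real n - 1) * (real n - 2) * (real n - 3) * (3 * real n ^ 2 - 12 * real n + 5)
            / (240 * real n)
        \<longleftrightarrow> (\<forall>i. 2 \<le> i \<and> i + 1 \<le> n - 1 \<longrightarrow> x (i + 1) = x i + 1)))"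
proof -
  define \<mu> where "\<mu> = arith_mean n x"
  \<comment> \<open>Integer coordinates with origin at the floor of the mean; they equal
    \<open>x i - \<mu>\<close> on the sample when the mean is an integer.\<close>
  define z where "z i = \<lfloor>x i\<rfloor> - \<lfloor>\<mu>\<rfloor>" for i
  define I where "I = {2..n - 1}"
  define S where "S = z ` I"
  define Q where "Q = (\<Sum>i\<in>I. (x i - \<mu>) ^ 4)"
  have fin: "finite S" unfolding S_def I_def by simp
  have x_eq: "x i = real_of_int (z i + \<lfloor>\<mu>\<rfloor>)" if "i \<in> {1..n}" for i
    using that assms(2) by (auto simp: z_def elim!: Ints_cases)
  have IN: "i \<in> {1..n}" if "i \<in> I" for i using that unfolding I_def by auto
  have mono: "z i < z j" if "i \<in> I" "j \<in> I" "i < j" for i j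
  proof -
    have "x i < x j"
      using assms(3) that IN by (auto simp: strict_mono_on_def)
    then show ?thesis using x_eq[of i] x_eq[of j] that IN by simp
  qed
  have inj: "inj_on z I"
    using mono by (intro linorder_inj_onI') fastforce
  have card: "card S = n - 2"
    unfolding S_def card_image[OF inj] by (simp add: I_def)
  have split: "(\<Sum>i=1..n. f i) = f 1 + f n + (\<Sum>i\<in>I. f i)" for f :: "nat \<Rightarrow> real"
  proof -
    have "{1..n} = insert 1 (insert n I)" using assms(1) by (auto simp: I_def)
    then show ?thesis using assms(1) by (simp add: I_def)
  qed
  have cm: "central_moment 4 n x = ((m - \<mu>) ^ 4 + (M - \<mu>) ^ 4 + Q) / real n"
    unfolding central_moment_def \<mu>_def[symmetric] split Q_def assms(4,5) by simp
  have npos: "real n > 0" using assms(1) by simp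
  \<comment> \<open>All four inequalities reduce to a bound on the interior sum \<open>Q\<close>;
    \<open>c\<close> will be the polynomial in the numerator over
    \<open>240 * real n\<close>.\<close>
  have bound: "(M - m) ^ 4 / (8 * real n) + c / (240 * real n) \<le> central_moment 4 n x"
    if "c \<le> 240 * Q" for c
  proof -
    have "((M - m) ^ 4 / 8 + c / 240) / real n \<le> central_moment 4 n x"
      unfolding cm using quartic_two_point[of M m \<mu>] that npos
      by (intro divide_right_mono) auto
    then show ?thesis by (simp add: add_divide_distrib)
  qed
  have Q_below: "real_of_int (sum quartic_below S) \<le> Q"
    unfolding Q_def S_def sum.reindex[OF inj] of_int_sum
    using quartic_below_le x_eq IN by (auto intro!: sum_mono)
  have Q_int: "Q = real_of_int (\<Sum>t\<in>S. t ^ 4)" if "\<mu> \<in> \<int>"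
    unfolding Q_def S_def sum.reindex[OF inj] of_int_sum
    using that x_eq IN by (intro sum.cong) (auto elim!: Ints_cases)
  show ?thesis
  proof (cases "even n")
    case True
    define N where "N = (n - 2) div 2"
    have n: "n = 2 * N + 2" using True assms(1) by (auto simp: N_def elim!: evenE)
    then have cardN: "card S = 2 * N" and n': "int n = 2 * int N + 2" using card by auto
    note bounds = sum_quartic_below_ge_centred[OF fin cardN] sum_quartic_ge_centred[OF fin cardN]
    have "real_of_int ((int n - 4) * (int n - 3) * (int n - 2) * (3 * int n ^ 2 - 18 * int n + 20))
        \<le> 240 * Q"
      unfolding sum_quartic_below_centred[OF n', symmetric] using bounds(1) Q_below
      by (simp del: of_int_sum)
    then have "central_moment 4 n x \<ge> (M - m) ^ 4 / (8 * real n)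
        + (real n - 4) * (real n - 3) * (real n - 2) * (3 * real n ^ 2 - 18 * real n + 20)
          / (240 * real n)"
      by (intro bound) simp
    moreover have "central_moment 4 n x \<ge> (M - m) ^ 4 / (8 * real n)
        + (real n - 2) * (3 * real n ^ 4 - 24 * real n ^ 3 + 92 * real n ^ 2 - 176 * real n + 120)
          / (240 * real n)" if "\<mu> \<in> \<int>"
    proof -
      have "real_of_int ((int n - 2)
          * (3 * int n ^ 4 - 24 * int n ^ 3 + 92 * int n ^ 2 - 176 * int n + 120)) \<le> 240 * Q"
        unfolding sum_quartic_centred[OF n', symmetric] Q_int[OF that] using bounds(2)
        by (simp del: of_int_sum)
      then show ?thesis by (intro bound) simp
    qed
    ultimately show ?thesis using True by (simp add: \<mu>_def)
  next
    case False
    define N where "N = (n - 3) div 2"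
    have n: "n = 2 * N + 3" using False assms(1) by (auto simp: N_def elim!: oddE)
    then have cardN: "card S = 2 * N + 1" and n': "int n = 2 * int N + 3" using card by auto
    note bounds =
      sum_quartic_below_ge_symmetric[OF fin cardN] sum_quartic_ge_symmetric(1)[OF fin cardN]
    define B where "B = (real n - 1) * (real n - 2) * (real n - 3) * (3 * real n ^ 2 - 12 * real n + 5)"
    have B: "B = 240 * real_of_int (\<Sum>t\<in>{- int N..int N}. t ^ 4)"
      using arg_cong[OF sum_quartic_symmetric[OF n'], of real_of_int]
      by (simp add: B_def del: of_int_sum)
    have "real_of_int ((int n - 3)
        * (3 * int n ^ 4 - 36 * int n ^ 3 + 182 * int n ^ 2 - 444 * int n + 415)) \<le> 240 * Q"
      unfolding sum_quartic_below_symmetric[OF n', symmetric] using bounds(1) Q_below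
      by (simp del: of_int_sum)
    then have "central_moment 4 n x \<ge> (M - m) ^ 4 / (8 * real n)
        + (real n - 3) * (3 * real n ^ 4 - 36 * real n ^ 3 + 182 * real n ^ 2 - 444 * real n + 415)
          / (240 * real n)"
      by (intro bound) simp
    moreover have "central_moment 4 n x \<ge> (M - m) ^ 4 / (8 * real n) + B / (240 * real n)"
      if "\<mu> \<in> \<int>"
      using bounds(2) by (intro bound) (simp add: B Q_int[OF that] del: of_int_sum)
    moreover have "central_moment 4 n x = (M - m) ^ 4 / (8 * real n) + B / (240 * real n)
        \<longleftrightarrow> (\<forall>i. 2 \<le> i \<and> i + 1 \<le> n - 1 \<longrightarrow> x (i + 1) = x i + 1)"
      if int: "\<mu> \<in> \<int>" and mid: "\<mu> = (m + M) / 2"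
    proof -
      \<comment> \<open>With the mean at the midpoint the two-point inequality is an equality, so
        the interior sum alone decides the equality case.\<close>
      have ends: "(m - \<mu>) ^ 4 + (M - \<mu>) ^ 4 = (M - m) ^ 4 / 8"
        unfolding mid by (simp add: power4_eq_xxxx field_simps)
      have "central_moment 4 n x = (M - m) ^ 4 / (8 * real n) + Q / real n"
        unfolding cm ends by (simp add: add_divide_distrib)
      then have "central_moment 4 n x = (M - m) ^ 4 / (8 * real n) + B / (240 * real n)
          \<longleftrightarrow> Q = B / 240"
        using npos by (auto simp: field_simps)
      also have "\<dots> \<longleftrightarrow> (\<Sum>t\<in>S. t ^ 4) = (\<Sum>t\<in>{- int N..int N}. t ^ 4)"
        unfolding Q_int[OF int] B by (simp del: of_int_sum)
      also have "\<dots> \<longleftrightarrow> S = {- int N..int N}"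
        by (rule sum_quartic_ge_symmetric(2)[OF fin cardN])
      also have "\<dots> \<longleftrightarrow> (\<forall>i. 2 \<le> i \<and> i + 1 \<le> n - 1 \<longrightarrow> z (i + 1) = z i + 1)"
      proof (intro iffI allI impI)
        fix i assume S: "S = {- int N..int N}" and i: "2 \<le> i \<and> i + 1 \<le> n - 1"
        then have iI: "i \<in> I" "i + 1 \<in> I" by (auto simp: I_def)
        have "z i \<in> S" "z (i + 1) \<in> S" using iI by (auto simp: S_def)
        moreover have less: "z i < z (i + 1)" using mono iI by simp
        \<comment> \<open>An increasing enumeration of an interval skips no value:
          \<open>z i + 1\<close> lies between \<open>z i\<close> and \<open>z (i + 1)\<close>, so it
          is some \<open>z j\<close>, and monotonicity forces \<open>j = i + 1\<close>.\<close>
        ultimately have "z i + 1 \<in> S" unfolding S by auto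
        then obtain j where j: "j \<in> I" "z j = z i + 1" by (auto simp: S_def)
        have "i < j" using j iI mono[of j i] by (cases i j rule: linorder_cases) auto
        moreover have "\<not> i + 1 < j" using j iI mono[of "i + 1" j] less by auto
        ultimately have "j = i + 1" by simp
        with j show "z (i + 1) = z i + 1" by simp
      next
        assume step: "\<forall>i. 2 \<le> i \<and> i + 1 \<le> n - 1 \<longrightarrow> z (i + 1) = z i + 1"
        \<comment> \<open>Unit steps make \<open>S\<close> a run of \<open>2 * N + 1\<close>
          consecutive integers starting at \<open>z 2\<close>; it remains to locate its
          centre.\<close>
        have z: "z (k + 2) = z 2 + int k" if "k \<le> 2 * N" for k
          using that
        proof (induction k)
          case (Suc k)
          then show ?case using step[rule_format, of "k + 2"] n by simp
        qed (simp add: numeral_2_eq_2)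
        have I_eq: "I = (\<lambda>k. k + 2) ` {..2 * N}"
          unfolding I_def n atMost_atLeast0 image_add_atLeastAtMost' by simp
        have S_eq: "S = (\<lambda>k. z 2 + int k) ` {..2 * N}"
          unfolding S_def I_eq image_image using z by (intro image_cong) simp_all
        \<comment> \<open>The extremes sum to \<open>2 * \<mu>\<close>, so the interior points also
          have mean \<open>\<mu>\<close>, and their shifted values \<open>z i\<close> sum to
          zero.\<close>
        have "(\<Sum>i=1..n. x i) = real n * \<mu>"
          using npos by (simp add: \<mu>_def arith_mean_def)
        then have "(\<Sum>i\<in>I. x i) = (real n - 2) * \<mu>"
          unfolding split assms(4,5)[symmetric] left_diff_distrib using mid
          by (simp add: eq_divide_eq) algebra
        also have "(\<Sum>i\<in>I. x i) = (\<Sum>i\<in>I. real_of_int (z i) + \<mu>)"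
          using int x_eq IN by (intro sum.cong) (auto elim!: Ints_cases)
        also have "\<dots> = real_of_int (\<Sum>i\<in>I. z i) + (real n - 2) * \<mu>"
          using assms(1) by (simp add: sum.distrib I_def of_nat_diff)
        finally have "(\<Sum>i\<in>I. z i) = 0" by (simp del: of_int_sum)
        moreover have "(\<Sum>i\<in>I. z i) = (\<Sum>k\<le>2 * N. z 2 + int k)"
          unfolding I_eq using z by (subst sum.reindex) (auto simp: inj_on_def)
        \<comment> \<open>The sum is the number of terms times the middle term
          \<open>z 2 + int N\<close>, so this middle term must vanish.\<close>
        moreover have "(\<Sum>k\<le>2 * N. z 2 + int k) = (2 * int N + 1) * (z 2 + int N)"
          by (induction N) (simp_all add: algebra_simps)
        ultimately have z2: "z 2 = - int N" by simp
        show "S = {- int N..int N}"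
        proof (rule card_subset_eq)
          show "S \<subseteq> {- int N..int N}" unfolding S_eq z2 by auto
          show "card S = card {- int N..int N}" using cardN by simp
        qed simp
      qed
      also have "\<dots> \<longleftrightarrow> (\<forall>i. 2 \<le> i \<and> i + 1 \<le> n - 1 \<longrightarrow> x (i + 1) = x i + 1)"
      proof -
        have "z (i + 1) = z i + 1 \<longleftrightarrow> x (i + 1) = x i + 1" if "2 \<le> i \<and> i + 1 \<le> n - 1" for i
        proof -
          have "x i = real_of_int (z i + \<lfloor>\<mu>\<rfloor>)" "x (i + 1) = real_of_int (z (i + 1) + \<lfloor>\<mu>\<rfloor>)"
            by (rule x_eq; use that in force)+
          then show ?thesis by simp linarith
        qed
        then show ?thesis by blast
      qed
      finally show ?thesis .
    qed
    ultimately show ?thesis using False by (simp add: \<mu>_def B_def)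
  qed
qed

end
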